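(* If $X_1^2+\dots+X_5^2=X_6^2$ for some $X_1,\dots,X_4\in\mathbb{R}_{11}$ and $X_5,X_6\in\mathbb{R}_{22}$ such that $X_5+X_6\in\mathbb{R}_{20}$ and $X_5-X_6\in\mathbb{R}_{02}$ have degree $2$, then for some $A\in\mathbb{H}_{10}$ and $B\in\mathbb{H}_{01}$ we have $$X_1+iX_2+jX_3+kX_4=AB\quad\text{or}\quad X_1+iX_2+jX_3+kX_4=BA.$$
   Context: $\mathbb{H}$ is the skew field of quaternions with the standard imaginary units $i,j,k$. $\mathbb{H}_{mn}\subset\mathbb{H}[u,v]$ (respectively $\mathbb{R}_{mn}\subset\mathbb{R}[u,v]$) is the set of polynomials with quaternionic (respectively real) coefficients of degree at most $m$ in $u$ and at most $n$ in $v$; the variables $u,v$ commute with each other and with the coefficients. *)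

theory Defs
  imports Complex_Main "HOL-Library.Poly_Mapping" "HOL-Library.Product_Plus"
begin

section \<open>Quaternions\<close>

codatatype quat = Quat (qRe: real) (qI: real) (qJ: real) (qK: real)

lemma quat_eqI [intro?]:
  "qRe x = qRe y \<Longrightarrow> qI x = qI y \<Longrightarrow> qJ x = qJ y \<Longrightarrow> qK x = qK y \<Longrightarrow> x = y"
  by (rule quat.expand) simp

lemma quat_eq_iff:
  "x = y \<longleftrightarrow> qRe x = qRe y \<and> qI x = qI y \<and> qJ x = qJ y \<and> qK x = qK y"
  by (auto intro: quat.expand)

instantiation quat :: ab_group_add
begin

primcorec zero_quat where
  "qRe 0 = 0" | "qI 0 = 0" | "qJ 0 = 0" | "qK 0 = 0"

primcorec plus_quat where
  "qRe (x + y) = qRe x + qRe y"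
| "qI (x + y) = qI x + qI y"
| "qJ (x + y) = qJ x + qJ y"
| "qK (x + y) = qK x + qK y"

primcorec uminus_quat where
  "qRe (- x) = - qRe x"
| "qI (- x) = - qI x"
| "qJ (- x) = - qJ x"
| "qK (- x) = - qK x"

primcorec minus_quat where
  "qRe (x - y) = qRe x - qRe y"
| "qI (x - y) = qI x - qI y"
| "qJ (x - y) = qJ x - qJ y"
| "qK (x - y) = qK x - qK y"

instance
  by standard (simp_all add: quat_eq_iff)

end

instantiation quat :: real_algebra_1
begin

primcorec one_quat where
  "qRe 1 = 1" | "qI 1 = 0" | "qJ 1 = 0" | "qK 1 = 0"

primcorec times_quat where
  "qRe (x * y) = qRe x * qRe y - qI x * qI y - qJ x * qJ y - qK x * qK y"
| "qI (x * y) = qRe x * qI y + qI x * qRe y + qJ x * qK y - qK x * qJ y"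
| "qJ (x * y) = qRe x * qJ y - qI x * qK y + qJ x * qRe y + qK x * qI y"
| "qK (x * y) = qRe x * qK y + qI x * qJ y - qJ x * qI y + qK x * qRe y"

primcorec scaleR_quat where
  "qRe (scaleR r x) = r * qRe x"
| "qI (scaleR r x) = r * qI x"
| "qJ (scaleR r x) = r * qJ x"
| "qK (scaleR r x) = r * qK x"

instance
  by standard (simp_all add: quat_eq_iff algebra_simps)

end

definition quat_normsq :: "quat \<Rightarrow> real"
  where "quat_normsq x = (qRe x)\<^sup>2 + (qI x)\<^sup>2 + (qJ x)\<^sup>2 + (qK x)\<^sup>2"

lemma quat_normsq_eq_0_iff [simp]: "quat_normsq x = 0 \<longleftrightarrow> x = 0"
  by (simp add: quat_normsq_def quat_eq_iff add_nonneg_eq_0_iff)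

instantiation quat :: real_div_algebra
begin

primcorec inverse_quat where
  "qRe (inverse x) = qRe x / quat_normsq x"
| "qI (inverse x) = - qI x / quat_normsq x"
| "qJ (inverse x) = - qJ x / quat_normsq x"
| "qK (inverse x) = - qK x / quat_normsq x"

definition "x div y = x * inverse y" for x y :: quat

instance
proof
  fix x y :: quat
  show "x div y = x * inverse y"
    by (rule divide_quat_def)
  show "inverse (0::quat) = 0"
    by (simp add: quat_eq_iff)
  assume "x \<noteq> 0"
  then have n: "quat_normsq x \<noteq> 0"
    by simp
  have e: "qRe x * qRe x + qI x * qI x + qJ x * qJ x + qK x * qK x = quat_normsq x"
    by (simp add: quat_normsq_def power2_eq_square)
  show "inverse x * x = 1" "x * inverse x = 1"
    using n e by (simp_all add: quat_eq_iff field_simps)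
qed

end

definition quat_i :: quat where "quat_i = Quat 0 1 0 0"
definition quat_j :: quat where "quat_j = Quat 0 0 1 0"
definition quat_k :: quat where "quat_k = Quat 0 0 0 1"

lemma quat_units_mult:
  "quat_i * quat_i = -1" "quat_j * quat_j = -1" "quat_k * quat_k = -1"
  "quat_i * quat_j = quat_k" "quat_j * quat_k = quat_i" "quat_k * quat_i = quat_j"
  "quat_j * quat_i = - quat_k" "quat_k * quat_j = - quat_i" "quat_i * quat_k = - quat_j"
  by (simp_all add: quat_eq_iff quat_i_def quat_j_def quat_k_def)

lemma quat_of_real_sel [simp]:
  "qRe (of_real r) = r" "qI (of_real r) = 0" "qJ (of_real r) = 0" "qK (of_real r) = 0"
  by (simp_all add: of_real_def)

lemma Quat_eq:
  "Quat a b c d = of_real a + quat_i * of_real b + quat_j * of_real c + quat_k * of_real d"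
  by (simp add: quat_eq_iff quat_i_def quat_j_def quat_k_def)


section \<open>Polynomials in two variables\<close>

text \<open>
  A polynomial in \<open>u\<close>, \<open>v\<close> is its finitely supported family of coefficients, indexed
  by the pair of exponents of \<open>u\<close> and \<open>v\<close>. The product of \<open>\<Rightarrow>\<^sub>0\<close> is convolution, which
  multiplies coefficients in the given order and adds exponents, so over a
  noncommutative ring the variables are central.
\<close>

type_synonym 'a bipoly = "nat \<times> nat \<Rightarrow>\<^sub>0 'a"

definition bipolys :: "nat \<Rightarrow> nat \<Rightarrow> 'a::zero bipoly set"
  where "bipolys m n = {p. \<forall>(a, b) \<in> Poly_Mapping.keys p. a \<le> m \<and> b \<le> n}"

abbreviation R_polys :: "nat \<Rightarrow> nat \<Rightarrow> real bipoly set"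
  where "R_polys \<equiv> bipolys"

abbreviation H_polys :: "nat \<Rightarrow> nat \<Rightarrow> quat bipoly set"
  where "H_polys \<equiv> bipolys"

text \<open>The zero polynomial gets degree \<open>0\<close>.\<close>

definition total_degree :: "'a::zero bipoly \<Rightarrow> nat"
  where "total_degree p = Max (insert 0 ((\<lambda>(a, b). a + b) ` Poly_Mapping.keys p))"

definition const_bipoly :: "'a::zero \<Rightarrow> 'a bipoly"
  where "const_bipoly c = Poly_Mapping.single (0, 0) c"

text \<open>The inclusion of real into quaternionic polynomials.\<close>

definition quat_bipoly :: "real bipoly \<Rightarrow> quat bipoly"
  where "quat_bipoly p = Poly_Mapping.map of_real p"

lemma lookup_quat_bipoly [simp]:
  "Poly_Mapping.lookup (quat_bipoly p) x = of_real (Poly_Mapping.lookup p x)"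
  by (simp add: quat_bipoly_def Poly_Mapping.map.rep_eq when_def)

end

theory Submission
  imports Defs "HOL-Analysis.Inner_Product"
begin

text \<open>
  Write \<open>Q = X1 + i X2 + j X3 + k X4 = d u v + b u + c v + a\<close>. The hypothesis says that
  \<open>|Q|\<^sup>2 = (X6 + X5) (X6 - X5)\<close> is a polynomial in \<open>u\<close> times a polynomial in \<open>v\<close>, so its matrix of
  coefficients has rank at most one. If \<open>d = 0\<close>, this gives \<open>|b|\<^sup>2 |c|\<^sup>2 = 0\<close>, so \<open>Q\<close> depends on
  one variable only. Otherwise divide by \<open>d\<close> on the left to get \<open>d = 1\<close>. Rank one now says that
  \<open>a\<close> has the same norm and the same inner products with \<open>1\<close>, \<open>b\<close> and \<open>c\<close> as \<open>b c\<close>, and hence as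
  \<open>c b\<close>. So \<open>z = a - b c\<close> and \<open>w = a - c b\<close> are orthogonal to each other and to \<open>1\<close>, \<open>b\<close>, \<open>c\<close>.
  Being imaginary and orthogonal, \<open>z\<close> and \<open>w\<close> anticommute; but \<open>z\<close> also commutes with
  \<open>w - z = b c - c b\<close>. Hence \<open>z w = 0\<close>, so that \<open>a = b c\<close> and \<open>Q = (v + b) (u + c)\<close>, or \<open>a = c b\<close>
  and \<open>Q = (u + c) (v + b)\<close>.
\<close>

unbundle inner_syntax

section \<open>Inner products of quaternions\<close>

instantiation quat :: real_inner
begin

definition inner_quat :: "quat \<Rightarrow> quat \<Rightarrow> real"
  where "x \<bullet> y = qRe x * qRe y + qI x * qI y + qJ x * qJ y + qK x * qK y"

definition norm_quat :: "quat \<Rightarrow> real"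
  where "norm x = sqrt (x \<bullet> x)" for x :: quat

definition sgn_quat :: "quat \<Rightarrow> quat"
  where "sgn x = x /\<^sub>R norm x" for x :: quat

definition dist_quat :: "quat \<Rightarrow> quat \<Rightarrow> real"
  where "dist x y = norm (x - y)" for x y :: quat

definition uniformity_quat :: "(quat \<times> quat) filter"
  where "uniformity_quat = (INF e\<in>{0 <..}. principal {(x, y). dist x y < e})"

definition open_quat :: "quat set \<Rightarrow> bool"
  where "open_quat U \<longleftrightarrow> (\<forall>x\<in>U. eventually (\<lambda>(x', y). x' = x \<longrightarrow> y \<in> U) uniformity)"

instance
proof
  fix x y z :: quat and r :: real
  have normsq: "x \<bullet> x = quat_normsq x"
    by (simp add: inner_quat_def quat_normsq_def power2_eq_square)
  show "0 \<le> x \<bullet> x"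
    unfolding normsq quat_normsq_def by simp
  show "x \<bullet> x = 0 \<longleftrightarrow> x = 0"
    unfolding normsq by simp
  show "x \<bullet> y = y \<bullet> x"
    by (simp add: inner_quat_def mult.commute)
  show "(x + y) \<bullet> z = x \<bullet> z + y \<bullet> z" "(r *\<^sub>R x) \<bullet> y = r * (x \<bullet> y)"
    by (simp_all add: inner_quat_def algebra_simps)
qed (simp_all add: norm_quat_def sgn_quat_def dist_quat_def uniformity_quat_def open_quat_def)

end

lemma quat_inner_1 [simp]: "1 \<bullet> x = qRe x" "x \<bullet> 1 = qRe x"
  by (simp_all add: inner_quat_def)

lemma quat_inner_mult_left: "(d * x) \<bullet> (d * y) = (d \<bullet> d) * (x \<bullet> y)" for d x y :: quat
  by (simp add: inner_quat_def algebra_simps)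

lemma quat_inner_mult_right: "(x * d) \<bullet> (y * d) = (x \<bullet> y) * (d \<bullet> d)" for d x y :: quat
  by (simp add: inner_quat_def algebra_simps)

lemma quat_inner_mult_self:
  "(x * y) \<bullet> x = qRe y * (x \<bullet> x)" "(x * y) \<bullet> y = qRe x * (y \<bullet> y)"
  using quat_inner_mult_left[of x y 1] quat_inner_mult_right[of x y 1] by simp_all

lemma qRe_mult: "qRe (x * y) = 2 * (qRe x * qRe y) - x \<bullet> y"
  by (simp add: inner_quat_def)

lemma quat_anticommutator:
  "x * y + y * x = (2 * qRe x) *\<^sub>R y + (2 * qRe y) *\<^sub>R x - (2 * (x \<bullet> y)) *\<^sub>R 1"
  by (simp add: quat_eq_iff inner_quat_def algebra_simps)

lemma quat_orthogonal_commutes_with_commutator: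
  fixes b c z :: quat
  assumes "qRe z = 0" "z \<bullet> b = 0" "z \<bullet> c = 0"
  shows "z * (b * c - c * b) = (b * c - c * b) * z"
proof -
  define b' c' where "b' = (2 * qRe b) *\<^sub>R 1 - b" and "c' = (2 * qRe c) *\<^sub>R 1 - c"
  have zb: "z * b = b' * z" and zc: "z * c = c' * z"
    using quat_anticommutator[of z b] quat_anticommutator[of z c] assms
    by (simp_all add: b'_def c'_def algebra_simps)
  have "z * (b * c - c * b) = (z * b) * c - (z * c) * b"
    by (simp add: right_diff_distrib mult.assoc)
  also have "\<dots> = (b' * c' - c' * b') * z"
    by (simp only: zb zc mult.assoc left_diff_distrib)
  also have "b' * c' - c' * b' = b * c - c * b"
    by (simp add: b'_def c'_def algebra_simps)
  finally show ?thesis .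
qed

lemma quat_eq_mult_or_eq_mult_swap:
  fixes a b c :: quat
  assumes re: "qRe a = qRe (b * c)"
    and inner_b: "a \<bullet> b = qRe c * (b \<bullet> b)"
    and inner_c: "a \<bullet> c = qRe b * (c \<bullet> c)"
    and inner_a: "a \<bullet> a = (b \<bullet> b) * (c \<bullet> c)"
  shows "a = b * c \<or> a = c * b"
proof -
  define z w where "z = a - b * c" and "w = a - c * b"
  have z: "qRe z = 0" "z \<bullet> b = 0" "z \<bullet> c = 0" and w: "qRe w = 0"
    using re by (simp_all add: z_def w_def inner_diff_left inner_b inner_c quat_inner_mult_self
        qRe_mult[of b c] qRe_mult[of c b] inner_commute[of c b] del: times_quat.sel)
  have "z \<bullet> w = a \<bullet> a - a \<bullet> (b * c + c * b) + (b * c) \<bullet> (c * b)"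
    by (simp add: z_def w_def inner_diff_left inner_diff_right inner_add_right inner_commute)
  also have "a \<bullet> (b * c + c * b) = (b * c) \<bullet> (b * c + c * b)"
    by (simp add: quat_anticommutator[of b c] re inner_b inner_c quat_inner_mult_self
        inner_add_right inner_diff_right del: times_quat.sel)
  finally have "z \<bullet> w = 0"
    using inner_a quat_inner_mult_left[of b c c] by (simp add: inner_add_right)
  then have "z * w + w * z = 0"
    using quat_anticommutator[of z w] z w by simp
  moreover have "z * w = w * z"
  proof -
    have "w = z + (b * c - c * b)"
      by (simp add: z_def w_def)
    then show ?thesis
      using quat_orthogonal_commutes_with_commutator[OF z] by (simp only: distrib_left distrib_right)
  qed
  ultimately have "z * w = 0"
    by (simp flip: mult_2)
  then show ?thesis
    by (simp add: z_def w_def)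
qed

lemma quat_eq_mult_inverse_mult_or_swap:
  fixes a b c d :: quat
  assumes "d \<noteq> 0"
    and ad: "(d \<bullet> d) * (a \<bullet> d + b \<bullet> c) = 2 * (b \<bullet> d) * (c \<bullet> d)"
    and ab: "(d \<bullet> d) * (a \<bullet> b) = (b \<bullet> b) * (c \<bullet> d)"
    and ac: "(d \<bullet> d) * (a \<bullet> c) = (c \<bullet> c) * (b \<bullet> d)"
    and aa: "(d \<bullet> d) * (a \<bullet> a) = (b \<bullet> b) * (c \<bullet> c)"
  shows "a = b * inverse d * c \<or> a = c * inverse d * b"
proof -
  define e where "e = inverse d"
  have d_e: "d * e = 1"
    using \<open>d \<noteq> 0\<close> by (simp add: e_def)
  have inner_e: "(e * x) \<bullet> (e * y) = (e \<bullet> e) * (x \<bullet> y)" for x y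
    by (rule quat_inner_mult_left)
  have re_e: "qRe (e * x) = (e \<bullet> e) * (x \<bullet> d)" for x
    using inner_e[of x d] \<open>d \<noteq> 0\<close> by (simp add: e_def)
  have norm_e: "(e \<bullet> e) * (d \<bullet> d) = 1"
    using re_e[of d] \<open>d \<noteq> 0\<close> by (simp add: e_def)
  have rescale: "(e \<bullet> e) * x = (e \<bullet> e) * (e \<bullet> e) * y" if "(d \<bullet> d) * x = y" for x y
    using that norm_e by (metis mult.assoc mult.left_neutral)
  have "e * a = (e * b) * (e * c) \<or> e * a = (e * c) * (e * b)"
  proof (rule quat_eq_mult_or_eq_mult_swap)
    show "qRe (e * a) = qRe ((e * b) * (e * c))"
      unfolding qRe_mult[of "e * b"] inner_e re_e using rescale[OF ad] by (simp add: algebra_simps)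
    show "(e * a) \<bullet> (e * b) = qRe (e * c) * ((e * b) \<bullet> (e * b))"
      unfolding inner_e re_e rescale[OF ab] by simp
    show "(e * a) \<bullet> (e * c) = qRe (e * b) * ((e * c) \<bullet> (e * c))"
      unfolding inner_e re_e rescale[OF ac] by simp
    show "(e * a) \<bullet> (e * a) = ((e * b) \<bullet> (e * b)) * ((e * c) \<bullet> (e * c))"
      unfolding inner_e rescale[OF aa] by simp
  qed
  moreover have "d * (e * x) = x" for x
    using d_e by (simp flip: mult.assoc)
  ultimately show ?thesis
    unfolding e_def[symmetric] by (metis mult.assoc)
qed

section \<open>Coefficients of polynomials in two variables\<close>

abbreviation coeff_uv :: "'a::zero bipoly \<Rightarrow> nat \<Rightarrow> nat \<Rightarrow> 'a"
  where "coeff_uv p i j \<equiv> Poly_Mapping.lookup p (i, j)"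

abbreviation monom_uv :: "'a::zero \<Rightarrow> nat \<Rightarrow> nat \<Rightarrow> 'a bipoly"
  where "monom_uv c i j \<equiv> Poly_Mapping.single (i, j) c"

lemma bipolys_iff_coeff_uv:
  "p \<in> bipolys m n \<longleftrightarrow> (\<forall>i j. i > m \<or> j > n \<longrightarrow> coeff_uv p i j = 0)"
  by (auto simp: bipolys_def in_keys_iff simp flip: not_le)

lemma coeff_uv_eq_0: "p \<in> bipolys m n \<Longrightarrow> i > m \<or> j > n \<Longrightarrow> coeff_uv p i j = 0"
  by (auto simp: bipolys_iff_coeff_uv)

lemma bipolys_lower_degree:
  shows "p \<in> bipolys (Suc m) n \<Longrightarrow> (\<And>j. j \<le> n \<Longrightarrow> coeff_uv p (Suc m) j = 0) \<Longrightarrow> p \<in> bipolys m n"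
    and "p \<in> bipolys m (Suc n) \<Longrightarrow> (\<And>i. i \<le> m \<Longrightarrow> coeff_uv p i (Suc n) = 0) \<Longrightarrow> p \<in> bipolys m n"
  by (auto simp: bipolys_iff_coeff_uv) (metis Suc_lessI not_le)+

lemma bipoly_eqI:
  "(\<And>i j. coeff_uv p i j = coeff_uv q i j) \<Longrightarrow> p = q"
  by (rule poly_mapping_eqI) auto

lemma bipoly_expand:
  fixes p :: "'a::comm_monoid_add bipoly"
  assumes "p \<in> bipolys m n"
  shows "p = (\<Sum>i\<le>m. \<Sum>j\<le>n. monom_uv (coeff_uv p i j) i j)"
proof (rule bipoly_eqI)
  fix k l
  have "coeff_uv (\<Sum>i\<le>m. \<Sum>j\<le>n. monom_uv (coeff_uv p i j) i j) k l
    = (\<Sum>i\<le>m. \<Sum>j\<le>n. if k = i then if l = j then coeff_uv p i j else 0 else 0)"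
    by (auto simp: lookup_sum lookup_single when_def intro!: sum.cong)
  also have "\<dots> = (\<Sum>i\<le>m. if k = i then \<Sum>j\<le>n. if l = j then coeff_uv p i j else 0 else 0)"
    by (intro sum.cong) auto
  also have "\<dots> = coeff_uv p k l"
    using assms by (auto simp: bipolys_iff_coeff_uv not_le)
  finally show "coeff_uv p k l = coeff_uv (\<Sum>i\<le>m. \<Sum>j\<le>n. monom_uv (coeff_uv p i j) i j) k l"
    by simp
qed

lemma coeff_uv_mult:
  fixes p q :: "'a::semiring_0 bipoly"
  shows "coeff_uv (p * q) i j = (\<Sum>k\<le>i. \<Sum>l\<le>j. coeff_uv p k l * coeff_uv q (i - k) (j - l))"
proof -
  define f where "f k = (\<Sum>k'. Poly_Mapping.lookup q k' when (i, j) = k + k')" for k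
  have f: "f (k, l) = (if k \<le> i \<and> l \<le> j then coeff_uv q (i - k) (j - l) else 0)" for k l
  proof (cases "k \<le> i \<and> l \<le> j")
    case True
    then have "(i, j) = (k, l) + k' \<longleftrightarrow> k' = (i - k, j - l)" for k'
      by (cases k') auto
    with True show ?thesis
      by (simp add: f_def)
  next
    case False
    then have "(i, j) \<noteq> (k, l) + k'" for k'
      by (cases k') auto
    with False show ?thesis
      by (auto simp: f_def)
  qed
  have "coeff_uv (p * q) i j = (\<Sum>k. Poly_Mapping.lookup p k * f k)"
    by (simp add: lookup_mult f_def)
  also have "\<dots> = (\<Sum>k\<in>{..i} \<times> {..j}. Poly_Mapping.lookup p k * f k)"
    by (rule Sum_any.expand_superset) (auto simp: f split: if_splits)
  also have "\<dots> = (\<Sum>k\<le>i. \<Sum>l\<le>j. coeff_uv p k l * f (k, l))"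
    by (simp add: sum.cartesian_product)
  finally show ?thesis
    by (simp add: f)
qed

lemma coeff_uv_mult_separated:
  fixes p q :: "'a::semiring_0 bipoly"
  assumes "p \<in> bipolys m 0" "q \<in> bipolys 0 n"
  shows "coeff_uv (p * q) i j = coeff_uv p i 0 * coeff_uv q 0 j"
proof -
  have "coeff_uv (p * q) i j
    = (\<Sum>k\<le>i. \<Sum>l\<le>j. if k = i then if l = 0 then coeff_uv p i 0 * coeff_uv q 0 j else 0 else 0)"
    unfolding coeff_uv_mult using assms by (intro sum.cong) (auto simp: bipolys_iff_coeff_uv)
  also have "\<dots> = (\<Sum>k\<le>i. if k = i then coeff_uv p i 0 * coeff_uv q 0 j else 0)"
    by (intro sum.cong) auto
  finally show ?thesis
    by simp
qed

lemma coeff_uv_mult_separated_exchange: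
  fixes p q :: "'a::comm_semiring_0 bipoly"
  assumes "p \<in> bipolys m 0" "q \<in> bipolys 0 n"
  shows "coeff_uv (p * q) i j * coeff_uv (p * q) k l = coeff_uv (p * q) i l * coeff_uv (p * q) k j"
  unfolding coeff_uv_mult_separated[OF assms] by (simp add: ac_simps)

lemma coeff_uv_map: "f 0 = 0 \<Longrightarrow> coeff_uv (Poly_Mapping.map f p) i j = f (coeff_uv p i j)"
  by (simp add: Poly_Mapping.map.rep_eq when_def)

section \<open>The norm of a quaternionic polynomial\<close>

definition normsq_bipoly :: "quat bipoly \<Rightarrow> real bipoly"
  where "normsq_bipoly p = (Poly_Mapping.map qRe p)\<^sup>2 + (Poly_Mapping.map qI p)\<^sup>2
    + (Poly_Mapping.map qJ p)\<^sup>2 + (Poly_Mapping.map qK p)\<^sup>2"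

lemma coeff_uv_normsq_bipoly:
  "coeff_uv (normsq_bipoly p) i j = (\<Sum>k\<le>i. \<Sum>l\<le>j. coeff_uv p k l \<bullet> coeff_uv p (i - k) (j - l))"
  by (simp add: normsq_bipoly_def power2_eq_square lookup_add coeff_uv_mult inner_quat_def
      coeff_uv_map sum.distrib)

lemma coeff_uv_normsq_bipoly_11:
  assumes "p \<in> H_polys 1 1"
  defines "a \<equiv> coeff_uv p 0 0" and "b \<equiv> coeff_uv p 1 0" and "c \<equiv> coeff_uv p 0 1"
    and "d \<equiv> coeff_uv p 1 1"
  shows "coeff_uv (normsq_bipoly p) 0 0 = a \<bullet> a"
    and "coeff_uv (normsq_bipoly p) 1 0 = 2 * (a \<bullet> b)"
    and "coeff_uv (normsq_bipoly p) 0 1 = 2 * (a \<bullet> c)"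
    and "coeff_uv (normsq_bipoly p) 1 1 = 2 * (a \<bullet> d + b \<bullet> c)"
    and "coeff_uv (normsq_bipoly p) 2 0 = b \<bullet> b"
    and "coeff_uv (normsq_bipoly p) 0 2 = c \<bullet> c"
    and "coeff_uv (normsq_bipoly p) 2 1 = 2 * (b \<bullet> d)"
    and "coeff_uv (normsq_bipoly p) 1 2 = 2 * (c \<bullet> d)"
    and "coeff_uv (normsq_bipoly p) 2 2 = d \<bullet> d"
  by (simp_all add: a_def b_def c_def d_def coeff_uv_normsq_bipoly numeral_2_eq_2
      coeff_uv_eq_0[OF assms(1)] inner_commute)

abbreviation (input) bipoly_of_components ::
    "real bipoly \<Rightarrow> real bipoly \<Rightarrow> real bipoly \<Rightarrow> real bipoly \<Rightarrow> quat bipoly"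
  where "bipoly_of_components X1 X2 X3 X4 \<equiv>
    quat_bipoly X1 + const_bipoly quat_i * quat_bipoly X2
      + const_bipoly quat_j * quat_bipoly X3 + const_bipoly quat_k * quat_bipoly X4"

lemma coeff_uv_bipoly_of_components:
  "coeff_uv (bipoly_of_components X1 X2 X3 X4) i j
    = Quat (coeff_uv X1 i j) (coeff_uv X2 i j) (coeff_uv X3 i j) (coeff_uv X4 i j)"
  unfolding const_bipoly_def zero_prod_def[symmetric] mult_map_scale_conv_mult[symmetric]
  by (simp add: lookup_add coeff_uv_map Quat_eq)

lemma normsq_bipoly_of_components:
  "normsq_bipoly (bipoly_of_components X1 X2 X3 X4) = X1\<^sup>2 + X2\<^sup>2 + X3\<^sup>2 + X4\<^sup>2"
proof -
  have "Poly_Mapping.map qRe (bipoly_of_components X1 X2 X3 X4) = X1"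
    "Poly_Mapping.map qI (bipoly_of_components X1 X2 X3 X4) = X2"
    "Poly_Mapping.map qJ (bipoly_of_components X1 X2 X3 X4) = X3"
    "Poly_Mapping.map qK (bipoly_of_components X1 X2 X3 X4) = X4"
    by (auto intro!: bipoly_eqI simp: coeff_uv_map coeff_uv_bipoly_of_components)
  then show ?thesis
    by (simp only: normsq_bipoly_def)
qed

section \<open>Factorization\<close>

lemma one_in_bipolys: "1 \<in> bipolys m n"
  by (simp add: bipolys_iff_coeff_uv lookup_one when_def zero_prod_def)

lemma monom_uv_linear_in_bipolys:
  "monom_uv a 1 0 + monom_uv b 0 0 \<in> bipolys 1 0"
  "monom_uv a 0 1 + monom_uv b 0 0 \<in> bipolys 0 1"
  by (auto simp: bipolys_iff_coeff_uv lookup_add lookup_single when_def)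

lemma bipoly_11_eq_mult_linear:
  fixes p :: "'a::division_ring bipoly"
  assumes "p \<in> bipolys 1 1"
  defines "a \<equiv> coeff_uv p 0 0" and "b \<equiv> coeff_uv p 1 0" and "c \<equiv> coeff_uv p 0 1"
    and "d \<equiv> coeff_uv p 1 1"
  assumes "d \<noteq> 0"
  shows "a = b * inverse d * c \<Longrightarrow>
      p = (monom_uv d 0 1 + monom_uv b 0 0) * (monom_uv 1 1 0 + monom_uv (inverse d * c) 0 0)"
    and "a = c * inverse d * b \<Longrightarrow>
      p = (monom_uv d 1 0 + monom_uv c 0 0) * (monom_uv 1 0 1 + monom_uv (inverse d * b) 0 0)"
proof -
  have p: "p = monom_uv a 0 0 + monom_uv c 0 1 + (monom_uv b 1 0 + monom_uv d 1 1)"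
    using bipoly_expand[OF assms(1)] by (simp add: a_def b_def c_def d_def)
  have cancel: "d * (inverse d * x) = x" for x
    using \<open>d \<noteq> 0\<close> by (simp flip: mult.assoc)
  show "p = (monom_uv d 0 1 + monom_uv b 0 0) * (monom_uv 1 1 0 + monom_uv (inverse d * c) 0 0)"
    if "a = b * inverse d * c"
    by (subst p) (simp add: that cancel distrib_left distrib_right mult_single ac_simps)
  show "p = (monom_uv d 1 0 + monom_uv c 0 0) * (monom_uv 1 0 1 + monom_uv (inverse d * b) 0 0)"
    if "a = c * inverse d * b"
    by (subst p) (simp add: that cancel distrib_left distrib_right mult_single ac_simps)
qed

theorem quat_bipoly_factorization_of_separated_normsq:
  assumes q: "q \<in> H_polys 1 1" and "p \<in> R_polys m 0" "r \<in> R_polys 0 n"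
    and norm: "normsq_bipoly q = p * r"
  shows "\<exists>A \<in> H_polys 1 0. \<exists>B \<in> H_polys 0 1. q = A * B \<or> q = B * A"
proof -
  define a b c d where abcd: "a = coeff_uv q 0 0" "b = coeff_uv q 1 0" "c = coeff_uv q 0 1"
    "d = coeff_uv q 1 1"
  note exchange = coeff_uv_mult_separated_exchange[OF assms(2,3), folded norm]
  note coeffs = coeff_uv_normsq_bipoly_11[OF q, folded abcd]
  show ?thesis
  proof (cases "d = 0")
    case True
    have "(b \<bullet> b) * (c \<bullet> c) = (d \<bullet> d) * (a \<bullet> a)"
      using exchange[of 2 0 0 2] by (simp add: coeffs)
    then have "q \<in> H_polys 0 1 \<or> q \<in> H_polys 1 0"
      using True q bipolys_lower_degree(1)[of q 0 1] bipolys_lower_degree(2)[of q 1 0]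
      by (auto simp: abcd le_Suc_eq)
    moreover have "q = 1 * q" "q = q * 1"
      by simp_all
    ultimately show ?thesis
      using one_in_bipolys by metis
  next
    case False
    then have "a = b * inverse d * c \<or> a = c * inverse d * b"
    proof (rule quat_eq_mult_inverse_mult_or_swap)
      show "(d \<bullet> d) * (a \<bullet> d + b \<bullet> c) = 2 * (b \<bullet> d) * (c \<bullet> d)"
        using exchange[of 2 2 1 1] unfolding coeffs by (simp add: distrib_left)
      show "(d \<bullet> d) * (a \<bullet> b) = (b \<bullet> b) * (c \<bullet> d)"
        using exchange[of 2 2 1 0] unfolding coeffs by simp
      show "(d \<bullet> d) * (a \<bullet> c) = (c \<bullet> c) * (b \<bullet> d)"
        using exchange[of 2 2 0 1] unfolding coeffs by simp
      show "(d \<bullet> d) * (a \<bullet> a) = (b \<bullet> b) * (c \<bullet> c)"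
        using exchange[of 2 2 0 0] unfolding coeffs by simp
    qed
    then show ?thesis
      using bipoly_11_eq_mult_linear[OF q, folded abcd, OF False] monom_uv_linear_in_bipolys by metis
  qed
qed

theorem corollary1p8:
  fixes X1 X2 X3 X4 X5 X6 :: "real bipoly"
  assumes "X1 \<in> R_polys 1 1" "X2 \<in> R_polys 1 1" "X3 \<in> R_polys 1 1" "X4 \<in> R_polys 1 1"
    and "X5 \<in> R_polys 2 2" "X6 \<in> R_polys 2 2"
    and "X1\<^sup>2 + X2\<^sup>2 + X3\<^sup>2 + X4\<^sup>2 + X5\<^sup>2 = X6\<^sup>2"
    and "X5 + X6 \<in> R_polys 2 0" "total_degree (X5 + X6) = 2"
    and "X5 - X6 \<in> R_polys 0 2" "total_degree (X5 - X6) = 2"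
  shows "\<exists>A \<in> H_polys 1 0. \<exists>B \<in> H_polys 0 1.
    quat_bipoly X1 + const_bipoly quat_i * quat_bipoly X2
      + const_bipoly quat_j * quat_bipoly X3 + const_bipoly quat_k * quat_bipoly X4 = A * B \<or>
    quat_bipoly X1 + const_bipoly quat_i * quat_bipoly X2
      + const_bipoly quat_j * quat_bipoly X3 + const_bipoly quat_k * quat_bipoly X4 = B * A"
    (is "\<exists>A \<in> _. \<exists>B \<in> _. ?Q = _ \<or> _")
proof (rule quat_bipoly_factorization_of_separated_normsq)
  show "?Q \<in> H_polys 1 1"
    using assms(1-4) by (simp add: bipolys_iff_coeff_uv coeff_uv_bipoly_of_components quat_eq_iff)
  show "X5 + X6 \<in> R_polys 2 0"
    by fact
  show "X6 - X5 \<in> R_polys 0 2"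
    using assms(10) by (simp add: bipolys_iff_coeff_uv lookup_minus)
  show "normsq_bipoly ?Q = (X5 + X6) * (X6 - X5)"
    unfolding normsq_bipoly_of_components using assms(7)
    by (simp add: power2_eq_square algebra_simps eq_diff_eq)
qed

end
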